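(* Let $f_n=S_n/T_n$ and $v_n=\frac{T_{n-2}T_{n+1}}{T_{n-1}T_n}$. Then, for every integer $n$ such that $f_n,\dots,f_{n+4}$ are finite and the denominators below are nonzero, \[ v_{n+2}^2=\frac{f_{n+1}^2f_{n+2}^3+f_{n+4}}{f_{n+3}(f_n^2-f_{n+2}f_{n+4})}, \qquad v_{n+3}^2=\frac{f_{n+2}^3f_{n+3}^2+f_{n}}{f_{n+1}(f_{n+4}^2-f_{n}f_{n+2})}. \]
   Context: $(S_n)_{n\in\mathbb{Z}}$ is the sequence with $S_{-2}=S_{-1}=S_0=S_1=S_2=1$ satisfying $S_{n+5}S_n=S_{n+4}S_{n+1}+S_{n+3}S_{n+2}$ for all $n\in\mathbb{Z}$ (positive integers, $S_{-n}=S_n$). $(T_n)_{n\in\mathbb{Z}}$ is defined by $T_1=1,T_2=-1,T_3=1,T_4=1,T_5=-7$, $T_{n+5}T_n=T_{n+4}T_{n+1}+T_{n+3}T_{n+2}$ for $n\geq1$, $T_0=0$ and $T_{-n}=-T_n$ (integers, nonzero for $n\neq0$). The pairs $(v_n,v_{n+1})$ form an orbit of the QRT map $(U,V)\mapsto(V,U^{-1}(1+V^{-1}))$. *)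

theory Defs
  imports Complex_Main
begin

definition is_S_seq :: "(int \<Rightarrow> rat) \<Rightarrow> bool" where
  "is_S_seq S \<longleftrightarrow>
     S (-2) = 1 \<and> S (-1) = 1 \<and> S 0 = 1 \<and> S 1 = 1 \<and> S 2 = 1 \<and>
     (\<forall>n. S (n+5) * S n = S (n+4) * S (n+1) + S (n+3) * S (n+2))"

definition is_T_seq :: "(int \<Rightarrow> rat) \<Rightarrow> bool" where
  "is_T_seq T \<longleftrightarrow>
     T 1 = 1 \<and> T 2 = -1 \<and> T 3 = 1 \<and> T 4 = 1 \<and> T 5 = -7 \<and>
     (\<forall>n\<ge>1. T (n+5) * T n = T (n+4) * T (n+1) + T (n+3) * T (n+2)) \<and>
     T 0 = 0 \<and> (\<forall>n. T (-n) = - T n)"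

text \<open>The value is meaningful (finite) only where \<open>T n \<noteq> 0\<close>.\<close>

definition f_seq :: "(int \<Rightarrow> rat) \<Rightarrow> (int \<Rightarrow> rat) \<Rightarrow> int \<Rightarrow> rat" where
  "f_seq S T n = S n / T n"

definition v_seq :: "(int \<Rightarrow> rat) \<Rightarrow> int \<Rightarrow> rat" where
  "v_seq T n = (T (n-2) * T (n+1)) / (T (n-1) * T n)"

end

theory Submission
  imports Defs
begin

text \<open>
  The sequences \<open>S\<close> and \<open>T\<close> behave like two theta functions along the same arithmetic
  progression, shifted against each other by a point of order two.
  Addition formulas then express \<open>S n * S (n+3)\<close>, \<open>T n * T (n+3)\<close>, \<open>S n * T (n+3)\<close> and
  \<open>S (n+3) * T n\<close> through the two middle terms, and \<open>S (n-1) * S (n+1)\<close>,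
  \<open>T (n-1) * T (n+1)\<close> and \<open>S (n-1) * T (n+1) + S (n+1) * T (n-1)\<close> through the central ones.
  These bilinear relations, whose coefficients depend on the parity of \<open>n\<close>, are propagated by
  the Somos-5 recurrence as long as nothing vanishes, and they imply the two formulas.

  That \<open>T k\<close> never vanishes for positive \<open>k\<close> is an arithmetic fact: \<open>T k = 0\<close> would give
  \<open>S (k-1) * S (k+2) = S k * S (k+1)\<close>, but \<open>S k\<close> is an integer greater than 1 that is coprime
  to its near neighbours. The formulas for negative indices follow by reflection.
\<close>

section \<open>Integrality and coprimality\<close>

text \<open>Modulo \<open>x5\<close> the recurrences read x1*x4 = -x2*x3, x1*x6 = x3*x4, x2*x7 =
  x3*x6, x3*x8 = x4*x7, x4*x9 = x6*x7. They annihilate the claimed multiple of \<open>x5\<close>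
  once it is multiplied by x1*x2*x3*x4, a unit modulo \<open>x5\<close>.\<close>

lemma somos5_dvd:
  fixes x0 x1 x2 x3 x4 x5 x6 x7 x8 x9 :: int
  assumes "x5*x0 = x4*x1 + x3*x2" "x6*x1 = x5*x2 + x4*x3" "x7*x2 = x6*x3 + x5*x4"
    "x8*x3 = x7*x4 + x6*x5" "x9*x4 = x8*x5 + x7*x6"
    and cop: "coprime x1 x5" "coprime x2 x5" "coprime x3 x5" "coprime x4 x5"
  shows "x5 dvd x9*x6 + x8*x7"
proof -
  have "x5 dvd (x1*x2*x3*x4) * (x9*x6 + x8*x7)"
    using assms(1-5) by algebra
  moreover have "coprime x5 (x1*x2*x3*x4)"
    using cop by (simp add: coprime_commute)
  ultimately show ?thesis
    by (simp add: coprime_dvd_mult_right_iff)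
qed

lemma coprime_somos5:
  fixes a b c d e x :: int
  assumes "e*x = a*b + c*d" "coprime a c" "coprime a d"
  shows "coprime a e"
proof (rule coprimeI)
  fix r assume r: "r dvd a" "r dvd e"
  then have "r dvd a*b + c*d" using assms(1) by (metis dvd_mult2)
  with r have "r dvd c*d" by (simp add: dvd_add_right_iff)
  moreover have "coprime a (c*d)" using assms by simp
  ultimately show "is_unit r" using r coprime_common_divisor by blast
qed

locale somos5 =
  fixes a :: "nat \<Rightarrow> rat"
  assumes init: "a 0 = 1" "a 1 = 1" "a 2 = 1" "a 3 = 1" "a 4 = 1"
    and rec: "\<And>k. a (k+5) * a k = a (k+4) * a (k+1) + a (k+3) * a (k+2)"
begin

lemma initial_values: "a 5 = 2" "a 6 = 3" "a 7 = 5" "a 8 = 11" "a 9 = 37"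
  using rec[of 0] rec[of 1] rec[of 2] rec[of 3] rec[of 4] init
  by (simp_all add: numeral_2_eq_2[symmetric] numeral_3_eq_3[symmetric])

lemma pos: "a k > 0"
proof (induction k rule: less_induct)
  case (less k)
  consider "k = 0" | "k = 1" | "k = 2" | "k = 3" | "k = 4" | "k \<ge> 5" by linarith
  then show ?case
  proof cases
    case 6
    define m where "m = k - 5"
    have k: "k = m + 5" using 6 by (simp add: m_def)
    have "a (m+5) * a m > 0" unfolding rec by (intro add_pos_pos mult_pos_pos less) (simp_all add: k)
    moreover have "a m > 0" using less k by simp
    ultimately show ?thesis unfolding k by (simp add: zero_less_mult_iff)
  qed (use init in simp_all)
qed

lemma mono: "a k \<le> a (Suc k)"
proof (induction k rule: less_induct)
  case (less k)
  consider "k = 0" | "k = 1" | "k = 2" | "k = 3" | "k \<ge> 4" by linarith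
  then show ?case
  proof cases
    case 5
    define m where "m = k - 4"
    have k: "k = m + 4" using 5 by (simp add: m_def)
    have "a (m+4) * a m \<le> a (m+4) * a (m+1)"
      using less[of m] pos[of "m+4"] k by simp
    also have "\<dots> \<le> a (m+5) * a m"
      unfolding rec using pos[of "m+3"] pos[of "m+2"] by (simp add: less_imp_le)
    finally show ?thesis using pos[of m] by (simp add: k eval_nat_numeral)
  qed (use init in \<open>simp_all add: eval_nat_numeral\<close>)
qed

lemma ge_2: "k \<ge> 5 \<Longrightarrow> a k \<ge> 2"
  using lift_Suc_mono_le[of a 5 k] mono initial_values(1) by simp

definition z :: "nat \<Rightarrow> int" where "z k = \<lfloor>a k\<rfloor>"

text \<open>Both claims need one joint induction: dividing by the term five places back requires its
  coprimality to the four terms before it, and coprimality of the new term is read off from the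
  recurrence over the integers.\<close>

lemma integral_coprime:
  "a k = of_int (z k) \<and> (\<forall>i<k. k \<le> i + 4 \<longrightarrow> coprime (z i) (z k))"
proof (induction k rule: less_induct)
  case (less k)
  have small: "z 0 = 1" "z 1 = 1" "z 2 = 1" "z 3 = 1" "z 4 = 1"
    using init by (simp_all add: z_def)
  show ?case
  proof (cases "k < 5")
    case True
    then have "k = 0 \<or> k = 1 \<or> k = 2 \<or> k = 3 \<or> k = 4" by linarith
    then have "z k = 1 \<and> a k = 1" using small init by (elim disjE) simp_all
    then show ?thesis by simp
  next
    case False
    have IH1: "a i = of_int (z i)" if "i < k" for i using less that by blast
    have IH2: "coprime (z i) (z j)" if "i < j" "j \<le> i + 4" "j < k" for i j using less that by blast
    have zrec: "z (i+5) * z i = z (i+4) * z (i+1) + z (i+3) * z (i+2)"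
      if "\<And>j. j \<le> i + 5 \<Longrightarrow> a j = of_int (z j)" for i
    proof -
      have "of_int (z (i+5) * z i) = (of_int (z (i+4) * z (i+1) + z (i+3) * z (i+2)) :: rat)"
        using rec[of i] that by simp
      then show ?thesis by (simp only: of_int_eq_iff)
    qed
    have int: "a k = of_int (z k)"
    \<comment> \<open>The divisibility lemma consumes the ten preceding terms, so the indices 5 to 9
      are checked by value.\<close>
    proof (cases "k < 10")
      case True
      then have "k = 5 \<or> k = 6 \<or> k = 7 \<or> k = 8 \<or> k = 9" using False by linarith
      then show ?thesis using initial_values by (auto simp: z_def)
    next
      case False
      define m where "m = k - 10"
      have k: "k = m + 10" using False by (simp add: m_def)
      have r: "z (i+5) * z i = z (i+4) * z (i+1) + z (i+3) * z (i+2)" if "i \<le> m + 4" for i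
        using zrec[of i] IH1 that k by simp
      have "z (m+5) dvd z (m+9) * z (m+6) + z (m+8) * z (m+7)"
        by (rule somos5_dvd[where ?x0.0 = "z m" and ?x1.0 = "z (m+1)" and ?x2.0 = "z (m+2)"
              and ?x3.0 = "z (m+3)" and ?x4.0 = "z (m+4)"])
          (use r[of m] r[of "m+1"] r[of "m+2"] r[of "m+3"] r[of "m+4"] IH2 k
            in \<open>simp_all add: eval_nat_numeral\<close>)
      then obtain q where q: "z (m+9) * z (m+6) + z (m+8) * z (m+7) = z (m+5) * q" by blast
      have "a (m+10) * a (m+5) = of_int (z (m+9) * z (m+6) + z (m+8) * z (m+7))"
        using rec[of "m+5"] IH1 k by (simp add: eval_nat_numeral)
      also have "\<dots> = a (m+5) * of_int q" unfolding q using IH1[of "m+5"] k by simp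
      finally have "a k = of_int q" using pos[of "m+5"] k by simp
      then show ?thesis by (simp add: z_def)
    qed
    define m where "m = k - 5"
    have k: "k = m + 5" using False by (simp add: m_def)
    have all: "a j = of_int (z j)" if "j \<le> m + 5" for j using IH1[of j] int k that by (cases "j = k") auto
    have r: "z (m+5) * z m = z (m+4) * z (m+1) + z (m+3) * z (m+2)"
      using zrec[of m] all by simp
    have c: "coprime (z (m+1)) (z (m+2))" "coprime (z (m+1)) (z (m+3))" "coprime (z (m+2)) (z (m+4))"
      "coprime (z (m+3)) (z (m+4))" "coprime (z (m+1)) (z (m+4))" "coprime (z (m+2)) (z (m+3))"
      using IH2 k by simp_all
    note c' = c c[THEN coprime_commute[THEN iffD1]]
    have "coprime (z (m+1)) (z (m+5))"
      by (rule coprime_somos5[where b = "z (m+4)" and c = "z (m+3)" and d = "z (m+2)" and x = "z m"])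
        (use r c' in \<open>simp_all add: algebra_simps\<close>)
    moreover have "coprime (z (m+2)) (z (m+5))"
      by (rule coprime_somos5[where b = "z (m+3)" and c = "z (m+4)" and d = "z (m+1)" and x = "z m"])
        (use r c' in \<open>simp_all add: algebra_simps\<close>)
    moreover have "coprime (z (m+3)) (z (m+5))"
      by (rule coprime_somos5[where b = "z (m+2)" and c = "z (m+4)" and d = "z (m+1)" and x = "z m"])
        (use r c' in \<open>simp_all add: algebra_simps\<close>)
    moreover have "coprime (z (m+4)) (z (m+5))"
      by (rule coprime_somos5[where b = "z (m+1)" and c = "z (m+3)" and d = "z (m+2)" and x = "z m"])
        (use r c' in \<open>simp_all add: algebra_simps\<close>)
    moreover have "i = m+1 \<or> i = m+2 \<or> i = m+3 \<or> i = m+4" if "i < k" "k \<le> i + 4" for i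
      using that k by linarith
    ultimately have "\<forall>i<k. k \<le> i + 4 \<longrightarrow> coprime (z i) (z k)" using k by metis
    with int show ?thesis by blast
  qed
qed

lemma outer_prod_neq_inner_prod:
  assumes "k \<ge> 4"
  shows "a k * a (k+3) \<noteq> a (k+1) * a (k+2)"
proof
  assume "a k * a (k+3) = a (k+1) * a (k+2)"
  moreover have z: "a j = of_int (z j)" for j using integral_coprime by blast
  ultimately have "(of_int (z k * z (k+3)) :: rat) = of_int (z (k+1) * z (k+2))" by simp
  then have "z k * z (k+3) = z (k+1) * z (k+2)" by (simp only: of_int_eq_iff)
  then have "z (k+1) dvd z k * z (k+3)" by simp
  moreover have "coprime (z k) (z (k+1))" "coprime (z (k+1)) (z (k+3))"
    using integral_coprime[of "k+1"] integral_coprime[of "k+3"] by simp_all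
  then have "coprime (z (k+1)) (z k * z (k+3))"
    by (simp add: coprime_commute[of "z (Suc k)" "z k"])
  ultimately have "is_unit (z (k+1))" using coprime_common_divisor[OF _ dvd_refl] by metis
  then have "z (k+1) \<le> 1" by (simp add: zdvd_imp_le)
  \<comment> \<open>Terms exceed 1 from index 5 on, whence the bound on \<open>k\<close>.\<close>
  moreover have "(2::rat) \<le> of_int (z (k+1))" using ge_2[of "k+1"] z[of "k+1"] assms by simp
  ultimately show False by linarith
qed

end

section \<open>Bilinear relations\<close>

text \<open>
  In both definitions \<open>x\<close> and \<open>y\<close> stand for consecutive terms of \<open>S\<close> and \<open>T\<close>. The coefficient
  \<open>c\<close> is 2 or 1 according to whether the first index (for \<open>window4\<close>) or the central
  index (for \<open>window3\<close>) is even or odd.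
\<close>

definition window4 :: "rat \<Rightarrow> rat \<Rightarrow> rat \<Rightarrow> rat \<Rightarrow> rat \<Rightarrow> rat \<Rightarrow> rat \<Rightarrow> rat \<Rightarrow> rat \<Rightarrow> bool" where
  "window4 c x0 x1 x2 x3 y0 y1 y2 y3 \<longleftrightarrow>
     x0*x3 = x1*x2 - y1*y2 \<and> y0*y3 = x1*x2 + y1*y2 \<and>
     x0*y3 = - c*x1*y2 - x2*y1 \<and> x3*y0 = - (3-c)*x2*y1 - x1*y2"

definition window3 :: "rat \<Rightarrow> rat \<Rightarrow> rat \<Rightarrow> rat \<Rightarrow> rat \<Rightarrow> rat \<Rightarrow> rat \<Rightarrow> bool" where
  "window3 c x0 x1 x2 y0 y1 y2 \<longleftrightarrow>
     (5-2*c)*x0*x2 = (3-c)*x1^2 + y1^2 \<and> (5-2*c)*y0*y2 = c*y1^2 - x1^2 \<and>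
     x0*y2 + x2*y0 = - (2*c-1)*x1*y1"

text \<open>Reversal exchanges the two mixed equations and hence \<open>c\<close> and
  \<open>3-c\<close>; this later turns the first formula into the second.\<close>

lemma window4_reverse:
  "window4 c x0 x1 x2 x3 y0 y1 y2 y3 \<Longrightarrow> window4 (3-c) x3 x2 x1 x0 y3 y2 y1 y0"
  by (simp add: window4_def algebra_simps)

lemma window3_reverse:
  "window3 c x0 x1 x2 y0 y1 y2 \<Longrightarrow> window3 c x2 x1 x0 y2 y1 y0"
  by (simp add: window3_def algebra_simps)

text \<open>Each new equation is multiplied by \<open>x0\<close> or \<open>y0\<close>, so that the
  given window eliminates \<open>x3\<close> and \<open>y3\<close>; the factor is then
  cancelled.\<close>

lemma window3_step:
  assumes c: "c = 1 \<or> c = 2"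
    and V: "window3 c x0 x1 x2 y0 y1 y2" and W: "window4 (3-c) x0 x1 x2 x3 y0 y1 y2 y3"
    and nz: "x0 \<noteq> 0" "y0 \<noteq> 0"
  shows "window3 (3-c) x1 x2 x3 y1 y2 y3"
proof -
  from W have x3: "x0*x3 = x1*x2 - y1*y2" and y3: "y0*y3 = x1*x2+y1*y2"
    and xy: "x0*y3 = - (3-c)*x1*y2 - x2*y1" by (simp_all add: window4_def)
  from c show ?thesis
  proof
    assume [simp]: "c = 1"
    from V have xx: "3*(x0*x2) = 2*x1^2 + y1^2" and yy: "3*(y0*y2) = y1^2 - x1^2"
      and s: "x0*y2+x2*y0 = - x1*y1" by (simp_all add: window3_def)
    have "x0 * (x1*x3) = x0*(x2^2 + y2^2)" using xx yy s x3 by algebra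
    moreover have "y0 * (y1*y3) = y0*(2*y2^2 - x2^2)" using xx yy s y3 by algebra
    moreover have "x0 * (x1*y3+x3*y1) = x0*(- 3*x2*y2)" using xx yy s x3 xy[simplified] by algebra
    ultimately show ?thesis
      unfolding mult_left_cancel[OF nz(1)] mult_left_cancel[OF nz(2)] by (simp add: window3_def)
  next
    assume [simp]: "c = 2"
    from V have xx: "x0*x2 = x1^2 + y1^2" and yy: "y0*y2 = 2*y1^2 - x1^2"
      and s: "x0*y2+x2*y0 = - 3*x1*y1" by (simp_all add: window3_def)
    have "x0 * (3*x1*x3) = x0*(2*x2^2 + y2^2)" using xx yy s x3 by algebra
    moreover have "y0 * (3*y1*y3) = y0*(y2^2 - x2^2)" using xx yy s y3 by algebra
    moreover have "x0 * (x1*y3+x3*y1) = x0*(- x2*y2)" using xx yy s x3 xy[simplified] by algebra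
    ultimately show ?thesis
      unfolding mult_left_cancel[OF nz(1)] mult_left_cancel[OF nz(2)] by (simp add: window3_def)
  qed
qed

lemma window4_step:
  assumes W0: "window4 c x0 x1 x2 x3 y0 y1 y2 y3"
    and W1: "window4 (3-c) x1 x2 x3 x4 y1 y2 y3 y4" and c: "c = 1 \<or> c = 2"
    and x5: "x5*x0 = x4*x1+x3*x2" and y5: "y5*y0 = y4*y1+y3*y2" and nz: "x0 \<noteq> 0" "y0 \<noteq> 0"
  shows "window4 c x2 x3 x4 x5 y2 y3 y4 y5"
proof -
  \<comment> \<open>This polynomial form of the case distinction lets \<open>algebra\<close> treat
    both parities at once.\<close>
  have c2: "c * (3-c) = 2" using c by auto
  from W0 have a: "x0*x3 = x1*x2 - y1*y2" "y0*y3 = x1*x2+y1*y2"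
     "x0*y3 = - c*x1*y2 - x2*y1" "x3*y0 = -(3-c)*x2*y1 - x1*y2" by (simp_all add: window4_def)
  from W1 have b: "x1*x4 = x2*x3 - y2*y3" "y1*y4 = x2*x3+y2*y3"
     "x1*y4 = - (3-c)*x2*y3 - x3*y2" "x4*y1 = - c*x3*y2 - x2*y3" by (simp_all add: window4_def)
  have X: "x0*x5 = 2*x2*x3 - y2*y3" using x5 b(1) by algebra
  have Y: "y0*y5 = x2*x3 + 2*y2*y3" using y5 b(2) by algebra
  \<comment> \<open>The first window removes \<open>x0\<close> or \<open>y0\<close>, the second
    removes \<open>x4\<close> and \<open>y4\<close>; every product becomes a polynomial in the
    middle terms \<open>x2\<close>, \<open>x3\<close>, \<open>y2\<close>, \<open>y3\<close>.\<close>
  have x34: "x0*(x3*x4) = x2*(x2*x3 - y2*y3) + y2*(c*x3*y2 + x2*y3)"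
    using a(1) b(1,4) by algebra
  have x34': "x0*(y3*y4) = y2*(2*x2*y3 + c*x3*y2) - x2*(x2*x3+y2*y3)"
    using a(3) b(2,3) c2 by algebra
  have x43: "x0*(x4*y3) = x2*(c*x3*y2 + x2*y3) - c*y2*(x2*x3-y2*y3)"
    using a(3) b(1,4) by algebra
  have x43': "x0*(x3*y4) = - x2*((3-c)*x2*y3 + x3*y2) - y2*(x2*x3+y2*y3)"
    using a(1) b(2,3) by algebra
  have y34: "y0*(x3*x4) = (3-c)*x2*(x2*y3) + 2*x2*x3*y2 - y2*(x2*x3-y2*y3)"
    using a(4) b(1,4) c2 by algebra
  have y34': "y0*(y3*y4) = - x2*((3-c)*x2*y3 + x3*y2) + y2*(x2*x3+y2*y3)"
    using a(2) b(2,3) by algebra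
  have y43: "y0*(x3*y4) = - (3-c)*x2*(x2*x3+y2*y3) + y2*((3-c)*x2*y3+x3*y2)"
    using a(4) b(2,3) by algebra
  have y43': "y0*(x4*y3) = x2*(x2*x3-y2*y3) - y2*(c*x3*y2+x2*y3)"
    using a(2) b(1,4) by algebra
  have "x0 * (x2*x5) = x0 * (x3*x4 - y3*y4)" using X x34 x34' by algebra
  moreover have "y0 * (y2*y5) = y0 * (x3*x4 + y3*y4)" using Y y34 y34' by algebra
  moreover have "y0 * (x2*y5) = y0 * (- c*x3*y4 - x4*y3)" using Y y43 y43' c2 by algebra
  moreover have "x0 * (x5*y2) = x0 * (-(3-c)*x4*y3 - x3*y4)" using X x43 x43' c2 by algebra
  ultimately show ?thesis
    unfolding mult_left_cancel[OF nz(1)] mult_left_cancel[OF nz(2)] by (simp add: window4_def)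
qed

text \<open>This is the first formula with denominators cleared. The two windows eliminate the outer
  terms, and the remaining polynomial vanishes by the three-term relations.\<close>

lemma window_identity:
  assumes W0: "window4 c x0 x1 x2 x3 y0 y1 y2 y3"
    and W1: "window4 (3-c) x1 x2 x3 x4 y1 y2 y3 y4" and c: "c = 1 \<or> c = 2" and V: "window3 c x1 x2 x3 y1 y2 y3"
  shows "y2*y3*y4*x0^2*x3 - y0^2*y3*x2*x3*x4 = y4*x1^2*x2^3 + x4*y1^2*y2^3"
proof -
  \<comment> \<open>The factors are paired so that \<open>x0\<close> and \<open>y0\<close> occur
    only in left-hand sides of the first window; the same is done below for \<open>x4\<close> and
    \<open>y4\<close>.\<close>
  have "y2*y3*y4*x0^2*x3 - y0^2*y3*x2*x3*x4 - y4*x1^2*x2^3 - x4*y1^2*y2^3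
    = y2*y4*(x0*y3)*(x0*x3) - x2*x4*(y0*y3)*(x3*y0) - y4*x1^2*x2^3 - x4*y1^2*y2^3"
    by algebra
  also have "\<dots> = y2*y4*(- c*x1*y2 - x2*y1)*(x1*x2 - y1*y2)
      - x2*x4*(x1*x2 + y1*y2)*(-(3-c)*x2*y1 - x1*y2) - y4*x1^2*x2^3 - x4*y1^2*y2^3"
    using W0 by (simp only: window4_def)
  also have "\<dots> = x1*(x1*y4)*(-c*x2*y2^2-x2^3)
      + x1*(y1*y4)*(c*y2^3-x2^2*y2) + x1*(x1*x4)*x2^2*y2 + y1*(y1*y4)*x2*y2^2
      + y1*(x1*x4)*((3-c)*x2^3+x2*y2^2) + y1*(x4*y1)*((3-c)*x2^2*y2-y2^3)"
    by algebra
  also have "\<dots> = x1*(- (3-c)*x2*y3 - x3*y2)*(-c*x2*y2^2-x2^3)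
      + x1*(x2*x3+y2*y3)*(c*y2^3-x2^2*y2) + x1*(x2*x3 - y2*y3)*x2^2*y2 + y1*(x2*x3+y2*y3)*x2*y2^2
      + y1*(x2*x3 - y2*y3)*((3-c)*x2^3+x2*y2^2)
      + y1*(-(3-(3-c))*x3*y2 - x2*y3)*((3-c)*x2^2*y2-y2^3)"
    using W1 by (simp only: window4_def)
  also have "\<dots> = 0"
    using c
  proof
    assume [simp]: "c = 1"
    from V have "3*(x1*x3) = 2*x2^2 + y2^2" and "3*(y1*y3) = y2^2 - x2^2"
      and "x1*y3+x3*y1 = - x2*y2" by (simp_all add: window3_def)
    then show ?thesis by simp algebra
  next
    assume [simp]: "c = 2"
    from V have "x1*x3 = x2^2 + y2^2" and "y1*y3 = 2*y2^2 - x2^2"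
      and "x1*y3+x3*y1 = - 3*x2*y2" by (simp_all add: window3_def)
    then show ?thesis by simp algebra
  qed
  finally show ?thesis by simp
qed

section \<open>The two sequences\<close>

lemma S_somos5:
  assumes "is_S_seq S"
  shows "somos5 (\<lambda>k. S (int k - 2))"
proof
  fix k
  show "S (int (k+5) - 2) * S (int k - 2)
      = S (int (k+4) - 2) * S (int (k+1) - 2) + S (int (k+3) - 2) * S (int (k+2) - 2)"
    using assms[unfolded is_S_seq_def, THEN conjunct2, THEN conjunct2, THEN conjunct2, THEN conjunct2,
        THEN conjunct2, rule_format, of "int k - 2"]
    by (simp add: algebra_simps)
qed (use assms in \<open>simp_all add: is_S_seq_def\<close>)

lemma S_pos:
  assumes "is_S_seq S" "n \<ge> -2"
  shows "S n > 0"
  using somos5.pos[OF S_somos5[OF assms(1)], of "nat (n+2)"] assms(2) by simp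

lemma S_outer_prod_neq_inner_prod:
  assumes "is_S_seq S" "n \<ge> 2"
  shows "S n * S (n+3) \<noteq> S (n+1) * S (n+2)"
  using somos5.outer_prod_neq_inner_prod[OF S_somos5[OF assms(1)], of "nat (n+2)"] assms(2)
  by (simp add: algebra_simps nat_le_iff)

lemma S_minus:
  assumes S: "is_S_seq S"
  shows "S (- n) = S n"
proof -
  have nat: "S (- int k) = S (int k)" for k
  proof (induction k rule: less_induct)
    case (less k)
    consider "k = 0" | "k = 1" | "k = 2" | "k \<ge> 3" by linarith
    then show ?case
    proof cases
      case 4
      have rec: "S (i+5) * S i = S (i+4) * S (i+1) + S (i+3) * S (i+2)" for i
        using S by (simp add: is_S_seq_def)
      have sym: "S (- i) = S i" if "\<bar>i\<bar> < int k" for i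
        using less[of "nat \<bar>i\<bar>"] that by (cases "i \<ge> 0") (auto simp: abs_if split: if_splits)
      define j where "j = int k"
      have "S (5-j) = S (j-5)" "S (4-j) = S (j-4)" "S (3-j) = S (j-3)" "S (2-j) = S (j-2)" "S (1-j) = S (j-1)"
        using sym[of "j-5"] sym[of "j-4"] sym[of "j-3"] sym[of "j-2"] sym[of "j-1"] 4
        by (simp_all add: j_def)
      \<comment> \<open>The recurrences at \<open>-j\<close> and \<open>j-5\<close> have equal
        right-hand sides by induction.\<close>
      then have "S (j-5) * S (-j) = S (j-5) * S j"
        using rec[of "-j"] rec[of "j-5"] by (simp add: algebra_simps)
      moreover have "S (j-5) > 0" using S_pos[OF S, of "j-5"] 4 by (simp add: j_def)
      ultimately show ?thesis by (simp add: j_def)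
    qed (use S in \<open>simp_all add: is_S_seq_def\<close>)
  qed
  show ?thesis
    using nat[of "nat n"] nat[of "nat (-n)"] by (cases "n \<ge> 0") simp_all
qed

definition parity_coeff :: "int \<Rightarrow> rat" where
  "parity_coeff n = (if even n then 2 else 1)"

lemma parity_coeff_cases: "parity_coeff n = 1 \<or> parity_coeff n = 2"
  by (simp add: parity_coeff_def)

lemma parity_coeff_Suc: "parity_coeff (n+1) = 3 - parity_coeff n"
  by (simp add: parity_coeff_def)

lemma parity_coeff_add_2: "parity_coeff (n+2) = parity_coeff n"
  by (simp add: parity_coeff_def)

definition somos4_rel :: "(int \<Rightarrow> rat) \<Rightarrow> (int \<Rightarrow> rat) \<Rightarrow> int \<Rightarrow> bool" where
  "somos4_rel S T n \<longleftrightarrow> window4 (parity_coeff n) (S n) (S (n+1)) (S (n+2)) (S (n+3))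
     (T n) (T (n+1)) (T (n+2)) (T (n+3))"

definition somos3_rel :: "(int \<Rightarrow> rat) \<Rightarrow> (int \<Rightarrow> rat) \<Rightarrow> int \<Rightarrow> bool" where
  "somos3_rel S T n \<longleftrightarrow> window3 (parity_coeff n) (S (n-1)) (S n) (S (n+1))
     (T (n-1)) (T n) (T (n+1))"

text \<open>Nonvanishing is part of the induction because advancing the windows cancels
  \<open>S n\<close> and \<open>T n\<close>. Two adjacent four-term relations are carried, as both
  are needed to produce the next one.\<close>

lemma bilinear_relations:
  assumes S: "is_S_seq S" and T: "is_T_seq T" and "n \<ge> 1"
  shows "T n \<noteq> 0 \<and> somos4_rel S T n \<and> somos4_rel S T (n+1) \<and> somos3_rel S T (n+1)"
  using \<open>n \<ge> 1\<close>
proof (induction n rule: int_ge_induct)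
  case base
  have "S 1 = 1" "S 2 = 1" "S 3 = 2" "S 4 = 3" "S 5 = 5"
    using somos5.init[OF S_somos5[OF S]] somos5.initial_values[OF S_somos5[OF S]] by simp_all
  with T show ?case
    by (simp add: is_T_seq_def somos4_rel_def somos3_rel_def window4_def window3_def parity_coeff_def)
next
  case (step n)
  then have Tn: "T n \<noteq> 0" and W0: "somos4_rel S T n" and W1: "somos4_rel S T (n+1)"
    and V1: "somos3_rel S T (n+1)" by auto
  have Sn: "S n \<noteq> 0" using S_pos[OF S, of n] step.hyps by simp
  \<comment> \<open>A zero here would make the outer and inner products of \<open>S\<close> agree in
    \<open>somos4_rel S T n\<close>; that is excluded only from index 2 on, so \<open>n = 1\<close>
    is read off from the initial data.\<close>
  have "T (n+1) \<noteq> 0"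
  proof (cases "n = 1")
    case True
    then show ?thesis using T by (simp add: is_T_seq_def)
  next
    case False
    then have "S n * S (n+3) \<noteq> S (n+1) * S (n+2)"
      using S_outer_prod_neq_inner_prod[OF S] step.hyps by simp
    then show ?thesis using W0 by (auto simp: somos4_rel_def window4_def)
  qed
  moreover have "somos4_rel S T (n+2)"
  proof -
    have "S (n+5) * S n = S (n+4) * S (n+1) + S (n+3) * S (n+2)"
      using S by (simp add: is_S_seq_def)
    moreover have "T (n+5) * T n = T (n+4) * T (n+1) + T (n+3) * T (n+2)"
      using T step.hyps by (simp add: is_T_seq_def)
    ultimately show ?thesis
      using window4_step[OF W0[unfolded somos4_rel_def], of "S (n+4)" "T (n+4)" "S (n+5)" "T (n+5)"]
        W1 Sn Tn parity_coeff_cases[of n]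
      by (simp add: somos4_rel_def parity_coeff_Suc parity_coeff_add_2 add.assoc)
  qed
  moreover have "somos3_rel S T (n+2)"
    using window3_step[of "parity_coeff (n+1)" "S n" "S (n+1)" "S (n+2)" "T n" "T (n+1)" "T (n+2)"
        "S (n+3)" "T (n+3)"] V1 W0 Sn Tn parity_coeff_cases[of "n+1"]
    by (simp add: somos3_rel_def somos4_rel_def parity_coeff_Suc parity_coeff_add_2 add.assoc
        add.commute[of 1 n])
  ultimately show ?case using W1 by (simp add: add.assoc)
qed

section \<open>The two formulas with denominators cleared\<close>

definition left_identity :: "(int \<Rightarrow> rat) \<Rightarrow> (int \<Rightarrow> rat) \<Rightarrow> int \<Rightarrow> bool" where
  "left_identity S T n \<longleftrightarrow>
     T (n+2) * T (n+3) * T (n+4) * (S n)\<^sup>2 * S (n+3) - (T n)\<^sup>2 * T (n+3) * S (n+2) * S (n+3) * S (n+4)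
       = T (n+4) * (S (n+1))\<^sup>2 * S (n+2) ^ 3 + S (n+4) * (T (n+1))\<^sup>2 * T (n+2) ^ 3"

definition right_identity :: "(int \<Rightarrow> rat) \<Rightarrow> (int \<Rightarrow> rat) \<Rightarrow> int \<Rightarrow> bool" where
  "right_identity S T n \<longleftrightarrow>
     T (n+2) * T (n+1) * T n * (S (n+4))\<^sup>2 * S (n+1) - (T (n+4))\<^sup>2 * T (n+1) * S (n+2) * S (n+1) * S n
       = T n * (S (n+3))\<^sup>2 * S (n+2) ^ 3 + S n * (T (n+3))\<^sup>2 * T (n+2) ^ 3"

lemma identities_pos:
  assumes S: "is_S_seq S" and T: "is_T_seq T" and n: "n \<ge> 1"
  shows "left_identity S T n \<and> right_identity S T n"
proof -
  define c where "c = parity_coeff n"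
  have W0: "window4 c (S n) (S (n+1)) (S (n+2)) (S (n+3)) (T n) (T (n+1)) (T (n+2)) (T (n+3))"
    using bilinear_relations[OF S T n] by (simp add: somos4_rel_def c_def)
  have W1: "window4 (3-c) (S (n+1)) (S (n+2)) (S (n+3)) (S (n+4))
      (T (n+1)) (T (n+2)) (T (n+3)) (T (n+4))"
    using bilinear_relations[OF S T n] by (simp add: somos4_rel_def c_def parity_coeff_Suc add.assoc)
  have V: "window3 c (S (n+1)) (S (n+2)) (S (n+3)) (T (n+1)) (T (n+2)) (T (n+3))"
    using bilinear_relations[OF S T, of "n+1"] n
    by (simp add: somos3_rel_def c_def parity_coeff_add_2 add.assoc add.commute[of 1 n])
  have c: "c = 1 \<or> c = 2" by (simp add: c_def parity_coeff_cases)
  have W1r: "window4 c (S (n+4)) (S (n+3)) (S (n+2)) (S (n+1))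
      (T (n+4)) (T (n+3)) (T (n+2)) (T (n+1))"
    using window4_reverse[OF W1] by simp
  show ?thesis
    using window_identity[OF W0 W1 c V]
      window_identity[OF W1r window4_reverse[OF W0] c window3_reverse[OF V]]
    by (simp add: left_identity_def right_identity_def)
qed

text \<open>Reflection maps the window at \<open>n\<close> to the one at \<open>m\<close>, which is
  positive, and exchanges the two identities. Every term has odd degree in \<open>T\<close>, so the
  signs from T (-i) = - T i cancel.\<close>

lemma identities_neg:
  assumes S: "is_S_seq S" and T: "is_T_seq T" and n: "n \<le> -5"
  shows "left_identity S T n \<and> right_identity S T n"
proof -
  define m where "m = - n - 4"
  have Tm: "T (- i) = - T i" for i using T by (simp add: is_T_seq_def)
  have "S (m+i) = S (n+4-i)" "T (m+i) = - T (n+4-i)" for i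
    using S_minus[OF S, of "n+4-i"] Tm[of "n+4-i"] by (simp_all add: m_def algebra_simps)
  from this[of 0] this[of 1] this[of 2] this[of 3] this[of 4]
  have eqs: "S m = S (n+4)" "S (m+1) = S (n+3)" "S (m+2) = S (n+2)" "S (m+3) = S (n+1)" "S (m+4) = S n"
    "T m = - T (n+4)" "T (m+1) = - T (n+3)" "T (m+2) = - T (n+2)" "T (m+3) = - T (n+1)" "T (m+4) = - T n"
    by (simp_all add: algebra_simps)
  have "left_identity S T m" "right_identity S T m"
    using identities_pos[OF S T, of m] n by (simp_all add: m_def)
  then show ?thesis
    unfolding left_identity_def right_identity_def eqs by algebra
qed

lemma quotient_identity:
  fixes x0 x1 x2 x3 x4 y0 y1 y2 y3 y4 :: rat
  assumes "y2*y3*y4*x0^2*x3 - y0^2*y3*x2*x3*x4 = y4*x1^2*x2^3 + x4*y1^2*y2^3"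
    and nz: "y0 \<noteq> 0" "y1 \<noteq> 0" "y2 \<noteq> 0" "y3 \<noteq> 0" "y4 \<noteq> 0"
    and den: "x3/y3 * ((x0/y0)^2 - x2/y2 * (x4/y4)) \<noteq> 0"
  shows "(y0*y3 / (y1*y2))^2 = ((x1/y1)^2 * (x2/y2)^3 + x4/y4) / (x3/y3 * ((x0/y0)^2 - x2/y2 * (x4/y4)))"
\<comment> \<open>After multiplication by the denominator both sides have the common denominator
  \<open>y1^2*y2^3*y4\<close>, and the numerators agree by the first assumption.\<close>
proof -
  have "(y0*y3 / (y1*y2))^2 * (x3/y3 * ((x0/y0)^2 - x2/y2 * (x4/y4)))
      = (y2*y3*y4*x0^2*x3 - y0^2*y3*x2*x3*x4) / (y1^2*y2^3*y4)"
    using nz by (simp add: field_simps power2_eq_square power3_eq_cube)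
  also have "\<dots> = (x1/y1)^2 * (x2/y2)^3 + x4/y4"
    unfolding assms(1) using nz by (simp add: field_simps power2_eq_square power3_eq_cube)
  finally show ?thesis by (simp only: nonzero_eq_divide_eq[OF den])
qed

theorem theorem4p2:
  fixes S T f v :: "int \<Rightarrow> rat" and n :: int
  assumes S: "is_S_seq S" and T: "is_T_seq T"
    and f: "f = f_seq S T" and v: "v = v_seq T"
    and finite_f: "\<And>i. i \<in> {n..n+4} \<Longrightarrow> T i \<noteq> 0"
    and denom1: "f (n+3) * ((f n)\<^sup>2 - f (n+2) * f (n+4)) \<noteq> 0"
    and denom2: "f (n+1) * ((f (n+4))\<^sup>2 - f n * f (n+2)) \<noteq> 0"
  shows "(v (n+2))\<^sup>2 =
           ((f (n+1))\<^sup>2 * (f (n+2)) ^ 3 + f (n+4)) /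
           (f (n+3) * ((f n)\<^sup>2 - f (n+2) * f (n+4)))
       \<and> (v (n+3))\<^sup>2 =
           ((f (n+2)) ^ 3 * (f (n+3))\<^sup>2 + f n) /
           (f (n+1) * ((f (n+4))\<^sup>2 - f n * f (n+2)))"
proof -
  have nz: "T n \<noteq> 0" "T (n+1) \<noteq> 0" "T (n+2) \<noteq> 0" "T (n+3) \<noteq> 0" "T (n+4) \<noteq> 0"
    using finite_f by simp_all
  have "T 0 = 0" using T by (simp add: is_T_seq_def)
  \<comment> \<open>Since \<open>T 0 = 0\<close>, the five indices all lie on one side of
    zero.\<close>
  then have "0 \<notin> {n..n+4}" using finite_f by blast
  then have "n \<ge> 1 \<or> n \<le> -5" by auto
  then have left: "left_identity S T n" and right: "right_identity S T n"
    using identities_pos[OF S T] identities_neg[OF S T] by auto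
  have f': "f i = S i / T i" for i by (simp add: f f_seq_def)
  \<comment> \<open>The factors of \<open>v (n+3)\<close> are ordered to match the reversed
    window.\<close>
  have "v (n+2) = T n * T (n+3) / (T (n+1) * T (n+2))"
    and "v (n+3) = T (n+4) * T (n+1) / (T (n+3) * T (n+2))"
    by (simp_all add: v v_seq_def algebra_simps)
  then show ?thesis
    using quotient_identity[OF left[unfolded left_identity_def] nz denom1[unfolded f']]
      quotient_identity[OF right[unfolded right_identity_def] nz(5,4,3,2,1)
        denom2[unfolded f' mult.commute[of "S n / T n"]]]
    by (simp only: f' mult.commute[of "S n / T n"] mult.commute[of "(S (n+2) / T (n+2)) ^ 3"])
qed

end
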